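(* Let $d$ and $n$ be positive integers with $n \geq d+1$ and $d \geq 4$, and let $\tau_1 < \cdots < \tau_n$ be integers. If $\tau_3 - \tau_2 = 1$ or $\tau_{n-1} - \tau_{n-2} = 1$, then the cyclic polytope $C_d(\tau_1,\ldots,\tau_n)$ is not very ample.
   Context: The cyclic polytope $C_d(\tau_1,\ldots,\tau_n) \subset \mathbb{R}^d$ is the convex hull of the points $(\tau_i, \tau_i^2, \ldots, \tau_i^d)$, $1 \leq i \leq n$. For an integral convex polytope $\mathcal{P} \subset \mathbb{R}^N$, let $\mathcal{P}^* \subset \mathbb{R}^{N+1}$ be the convex hull of all points $(1,\alpha)$ with $\alpha \in \mathcal{P}$, and $\mathcal{A}_{\mathcal{P}} = \mathcal{P}^* \cap \mathbb{Z}^{N+1}$. The polytope $\mathcal{P}$ is called very ample if the set $(\mathbb{Z}\mathcal{A}_{\mathcal{P}} \cap \mathbb{Q}_{\geq 0}\mathcal{A}_{\mathcal{P}}) \setminus \mathbb{Z}_{\geq 0}\mathcal{A}_{\mathcal{P}}$ is finite. *)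

theory Defs
  imports "HOL-Analysis.Analysis"
begin

text \<open>
  The space \<open>\<real>\<^sup>d\<close> is \<open>real ^ 'd\<close> for a finite linearly ordered index type of \<open>d\<close> elements.
  Since \<open>card {..i}\<close> is the position of \<open>i\<close>, counted from 1, in this order, the coordinates of
  \<open>moment_curve t\<close> in increasing order of the index are \<open>t, t\<^sup>2, \<dots>, t\<^sup>d\<close>.
\<close>

definition moment_curve :: "real \<Rightarrow> real ^ 'd::{finite,linorder}" where
  "moment_curve t = (\<chi> i. t ^ card {..i})"

definition cyclic_polytope :: "nat \<Rightarrow> (nat \<Rightarrow> real) \<Rightarrow> (real ^ 'd::{finite,linorder}) set" where
  "cyclic_polytope n \<tau> = convex hull {moment_curve (\<tau> i) | i. 1 \<le> i \<and> i \<le> n}"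

definition integer_points :: "(real ^ 'd) set" where
  "integer_points = {x. \<forall>i. x $ i \<in> \<int>}"

definition integral_polytope :: "(real ^ 'd) set \<Rightarrow> bool" where
  "integral_polytope P \<longleftrightarrow> polytope P \<and> {x. x extreme_point_of P} \<subseteq> integer_points"

text \<open>\<open>\<real>\<^sup>N\<^sup>+\<^sup>1\<close> is \<open>real \<times> (real ^ 'd)\<close>, so that \<open>\<int>\<^sup>N\<^sup>+\<^sup>1\<close> is \<open>\<int> \<times> integer_points\<close>.\<close>

definition homogenization :: "(real ^ 'd) set \<Rightarrow> (real \<times> (real ^ 'd)) set" where
  "homogenization P = convex hull {(1, \<alpha>) | \<alpha>. \<alpha> \<in> P}"

definition lattice_config :: "(real ^ 'd) set \<Rightarrow> (real \<times> (real ^ 'd)) set" where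
  "lattice_config P = homogenization P \<inter> (\<int> \<times> integer_points)"

text \<open>All finite linear combinations of elements of \<open>A\<close> with coefficients in \<open>R\<close>.\<close>

definition combinations :: "real set \<Rightarrow> 'a::real_vector set \<Rightarrow> 'a set" where
  "combinations R A =
    {\<Sum>a\<in>F. c a *\<^sub>R a | F c. finite F \<and> F \<subseteq> A \<and> (\<forall>a\<in>F. c a \<in> R)}"

text \<open>This notion is meant for integral polytopes only; see \<open>integral_polytope_cyclic_polytope\<close>
  below for the cyclic polytopes.\<close>

definition very_ample :: "(real ^ 'd) set \<Rightarrow> bool" where
  "very_ample P \<longleftrightarrow>
    finite ((combinations \<int> (lattice_config P) \<inter> combinations {q \<in> \<rat>. 0 \<le> q} (lattice_config P))
              - combinations \<nat> (lattice_config P))"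

lemma integral_polytope_cyclic_polytope:
  fixes \<tau> :: "nat \<Rightarrow> int"
  shows "integral_polytope (cyclic_polytope n (\<lambda>i. of_int (\<tau> i)) :: (real ^ 'd::{finite,linorder}) set)"
proof -
  let ?V = "{moment_curve (of_int (\<tau> i)) | i. 1 \<le> i \<and> i \<le> n} :: (real ^ 'd::{finite,linorder}) set"
  have "?V = (\<lambda>i. moment_curve (of_int (\<tau> i))) ` {1..n}"
    by auto
  then have "finite ?V"
    by simp
  then have "polytope (convex hull ?V)"
    unfolding polytope_def by blast
  moreover have "?V \<subseteq> integer_points"
    by (auto simp: integer_points_def moment_curve_def)
  ultimately show ?thesis
    unfolding integral_polytope_def cyclic_polytope_def
    using extreme_point_of_convex_hull by blast
qed

end

(* Reparametrise the moment curve by t = t0 + s u with s = 1 or s = -1, so that the two consecutive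
   parameters become u = 0 and u = 1, the outer neighbour -a, the next parameter c and the last one b.
   Write V u for the homogenized curve and E2, E3, E4 for its divided differences at (-a, 0, 1),
   (-a, 0, 1, c), (-a, 0, 1, c, b). By Newton interpolation these are lattice vectors, and
     x = V 0 + V 1 + E2 + c E3 + E4
   lies in the group and in the cone of the lattice points A of the polytope. All the points
   x + k V 0 are holes: since d >= 4, every integer polynomial in u of degree at most 4 is the
   restriction to the curve of an integral linear functional. The polynomial u (u - 1) is nonnegative on A and has value 1
   on x + k V 0, hence any representation has the form p + m V 0 + m' V 1 with p in A. Then
   u (u + a) (u - c) (u - c - 1) forces m' = 0, and (u + a) (u - 1) (u - c) (b - u) would be negative
   on p = x - V 0. *)

theory Submission
  imports Defs "HOL-Computational_Algebra.Polynomial"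
begin

section \<open>Closure of integral, rational and natural combinations\<close>

lemma combinations_base:
  assumes "a \<in> A" "r \<in> R"
  shows "r *\<^sub>R a \<in> combinations R A"
  unfolding combinations_def using assms
  by (intro CollectI exI[of _ "{a}"] exI[of _ "\<lambda>_. r"]) auto

lemma combinations_add:
  assumes R: "0 \<in> R" "\<And>r s. r \<in> R \<Longrightarrow> s \<in> R \<Longrightarrow> r + s \<in> R"
    and x: "x \<in> combinations R A" and y: "y \<in> combinations R A"
  shows "x + y \<in> combinations R A"
proof -
  obtain F c where F: "finite F" "F \<subseteq> A" "\<forall>a\<in>F. c a \<in> R" "x = (\<Sum>a\<in>F. c a *\<^sub>R a)"
    using x unfolding combinations_def by blast
  obtain G e where G: "finite G" "G \<subseteq> A" "\<forall>a\<in>G. e a \<in> R" "y = (\<Sum>a\<in>G. e a *\<^sub>R a)"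
    using y unfolding combinations_def by blast
  \<comment> \<open>The supports \<open>F\<close> and \<open>G\<close> may overlap, so both
    coefficient functions are extended by zero to \<open>F \<union> G\<close> before they are
    added.\<close>
  define h where "h a = (if a \<in> F then c a else 0) + (if a \<in> G then e a else 0)" for a
  have "x = (\<Sum>a\<in>F \<union> G. (if a \<in> F then c a else 0) *\<^sub>R a)"
    unfolding F(4) using F(1) G(1) by (intro sum.mono_neutral_cong_left) auto
  moreover have "y = (\<Sum>a\<in>F \<union> G. (if a \<in> G then e a else 0) *\<^sub>R a)"
    unfolding G(4) using F(1) G(1) by (intro sum.mono_neutral_cong_left) auto
  ultimately have "x + y = (\<Sum>a\<in>F \<union> G. h a *\<^sub>R a)"
    unfolding h_def scaleR_add_left sum.distrib by simp
  moreover have "\<forall>a\<in>F \<union> G. h a \<in> R"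
    using F(3) G(3) R unfolding h_def by auto
  ultimately show ?thesis
    unfolding combinations_def using F(1,2) G(1,2)
    by (intro CollectI exI[of _ "F \<union> G"] exI[of _ h]) auto
qed

section \<open>Integer polynomials as integral functionals on the moment curve\<close>

lemma bij_betw_card_atMost:
  "bij_betw (\<lambda>i. card {..i}) (UNIV :: 'd::{finite,linorder} set) {1..CARD('d)}"
proof -
  have "strict_mono (\<lambda>i::'d. card {..i})"
  proof (rule strict_monoI)
    fix i j :: 'd assume "i < j"
    then have "{..i} \<subset> {..j}" by auto
    then show "card {..i} < card {..j}" by (rule psubset_card_mono[OF finite])
  qed
  then have inj: "inj (\<lambda>i::'d. card {..i})"
    by (rule strict_mono_imp_inj_on)
  have "(\<lambda>i::'d. card {..i}) ` UNIV \<subseteq> {1..CARD('d)}"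
  proof (intro image_subsetI)
    fix i :: 'd
    have "1 \<le> card {..i}" by (auto simp: Suc_le_eq card_gt_0_iff)
    moreover have "card {..i} \<le> CARD('d)" by (intro card_mono) auto
    ultimately show "card {..i} \<in> {1..CARD('d)}" by (rule atLeastAtMost_iff[THEN iffD2, OF conjI])
  qed
  then have "range (\<lambda>i::'d. card {..i}) = {1..CARD('d)}"
    using card_image[OF inj] by (intro card_subset_eq) auto
  with inj show ?thesis unfolding bij_betw_def by simp
qed

text \<open>The coefficients of \<open>p\<close> themselves form the functional: the constant term
  is paired with the homogenizing coordinate, the coefficient of degree \<open>k\<close> with the
  coordinate \<open>t ^ k\<close>. The degree bound ensures that no coefficient is lost.\<close>

lemma polynomial_functional:
  fixes p :: "int poly"
  assumes "degree p \<le> CARD('d::{finite,linorder})"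
  obtains L :: "real \<times> (real ^ 'd::{finite,linorder}) \<Rightarrow> real"
  where "linear L" "\<And>t. L (1, moment_curve (of_int t)) = of_int (poly p t)"
    "\<And>z. z \<in> \<int> \<times> integer_points \<Longrightarrow> L z \<in> \<int>"
proof -
  define L :: "real \<times> (real ^ 'd::{finite,linorder}) \<Rightarrow> real" where
    "L z = of_int (coeff p 0) * fst z + (\<Sum>i\<in>UNIV. of_int (coeff p (card {..i})) * snd z $ i)" for z
  have "linear L"
    by (rule linearI) (auto simp: L_def algebra_simps sum.distrib sum_distrib_left)
  moreover have "L (1, moment_curve (of_int t)) = of_int (poly p t)" for t
  proof -
    have "(\<Sum>i\<in>(UNIV::'d set). of_int (coeff p (card {..i})) * real_of_int t ^ card {..i})
        = (\<Sum>k\<in>{1..CARD('d)}. of_int (coeff p k) * real_of_int t ^ k)"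
      by (rule sum.reindex_bij_betw[OF bij_betw_card_atMost])
    moreover have "of_int (poly p t) = (\<Sum>k\<le>CARD('d). of_int (coeff p k) * real_of_int t ^ k)"
    proof -
      have "poly p t = (\<Sum>k\<le>degree p. coeff p k * t ^ k)"
        by (rule poly_altdef)
      also have "\<dots> = (\<Sum>k\<le>CARD('d). coeff p k * t ^ k)"
        using assms by (intro sum.mono_neutral_left) (auto simp: coeff_eq_0)
      finally show ?thesis by simp
    qed
    moreover have "{..CARD('d)} = insert 0 {1..CARD('d)}" by auto
    ultimately show ?thesis
      by (simp add: L_def moment_curve_def)
  qed
  moreover have "L z \<in> \<int>" if "z \<in> \<int> \<times> integer_points" for z
    using that unfolding L_def integer_points_def by (auto intro!: Ints_add Ints_mult Ints_sum)
  ultimately show ?thesis by (rule that)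
qed

lemma lattice_config_convex_hull:
  "lattice_config (convex hull S) = convex hull ({1} \<times> S) \<inter> (\<int> \<times> integer_points)"
proof -
  have "{(1::real, \<alpha>) | \<alpha>. \<alpha> \<in> convex hull S} = convex hull ({1} \<times> S)"
    by (auto simp: convex_hull_Times)
  then show ?thesis
    by (simp add: lattice_config_def homogenization_def hull_hull)
qed

lemma linear_nonneg_on_convex_hull:
  fixes L :: "'a::real_vector \<Rightarrow> real"
  assumes "linear L" "\<And>y. y \<in> S \<Longrightarrow> 0 \<le> L y" "z \<in> convex hull S"
  shows "0 \<le> L z"
proof -
  have "convex {z. 0 \<le> L z}"
    using assms(1) by (auto simp: convex_def linear_add linear_scale)
  then have "convex hull S \<subseteq> {z. 0 \<le> L z}"
    using assms(2) by (intro hull_minimal) auto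
  with assms(3) show ?thesis by auto
qed

text \<open>Five synthetic divisions by monic linear factors. Being monic they stay within integer
  polynomials, so all Newton coefficients are integers; this makes divided differences of the curve
  lattice vectors.\<close>

lemma newton_form:
  fixes \<phi> :: "int poly" and x0 x1 x2 x3 x4 :: int
  obtains e0 e1 e2 e3 e4 r where
    "\<And>u. poly \<phi> u = e0 + (u - x0) * (e1 + (u - x1) * (e2 + (u - x2) *
       (e3 + (u - x3) * (e4 + (u - x4) * r u))))"
proof -
  have step: "\<exists>e q. \<forall>u. poly p u = e + (u - x) * poly q u" for p :: "int poly" and x
  proof (intro exI allI)
    fix u
    have "poly p u = poly ([:- x, 1:] * synthetic_div p x + [:poly p x:]) u"
      by (simp only: synthetic_div_correct')
    then show "poly p u = poly p x + (u - x) * poly (synthetic_div p x) u"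
      by (simp add: algebra_simps)
  qed
  obtain e0 p0 where 0: "\<forall>u. poly \<phi> u = e0 + (u - x0) * poly p0 u" using step by blast
  obtain e1 p1 where 1: "\<forall>u. poly p0 u = e1 + (u - x1) * poly p1 u" using step by blast
  obtain e2 p2 where 2: "\<forall>u. poly p1 u = e2 + (u - x2) * poly p2 u" using step by blast
  obtain e3 p3 where 3: "\<forall>u. poly p2 u = e3 + (u - x3) * poly p3 u" using step by blast
  obtain e4 p4 where 4: "\<forall>u. poly p3 u = e4 + (u - x4) * poly p4 u" using step by blast
  show ?thesis
    by (rule that[of e0 e1 e2 e3 e4 "poly p4"]) (simp only: 0 1 2 3 4)
qed

section \<open>Normalised parameters and coordinates\<close>

text \<open>\<open>U\<close> holds the parameters of all vertices; they may be more than the five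
  named nodes, but the others lie between \<open>c\<close> and \<open>b\<close>. Making
  \<open>V\<close> a parameter with a defining equation ties the index type \<open>'d\<close> to the
  locale.\<close>

locale consecutive_pair =
  fixes s t0 a b c :: int and U :: "int set" and V :: "int \<Rightarrow> real \<times> (real ^ 'd::{finite,linorder})"
  assumes V_def: "V = (\<lambda>u. (1, moment_curve (of_int (t0 + s * u))))"
    and s: "s * s = 1"
    and abc: "1 \<le> a" "2 \<le> c" "c < b"
    and U: "finite U" "{- a, 0, 1, c, b} \<subseteq> U" "U \<subseteq> {- a, 0, 1} \<union> {c..b}"
    and dim: "4 \<le> CARD('d)"
begin

abbreviation lattice :: "(real \<times> (real ^ 'd::{finite,linorder})) set" where
  "lattice \<equiv> \<int> \<times> integer_points"

definition A :: "(real \<times> (real ^ 'd::{finite,linorder})) set" where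
  "A = convex hull (V ` U) \<inter> lattice"

definition pt :: "real \<Rightarrow> real \<Rightarrow> real \<Rightarrow> real \<Rightarrow> real \<Rightarrow> real \<times> (real ^ 'd::{finite,linorder})" where
  "pt x1 x2 x3 x4 x5 = x1 *\<^sub>R V (- a) + x2 *\<^sub>R V 0 + x3 *\<^sub>R V 1 + x4 *\<^sub>R V c + x5 *\<^sub>R V b"

lemma A_eq: "A = lattice_config (convex hull ((\<lambda>u. moment_curve (of_int (t0 + s * u))) ` U))"
proof -
  have "V ` U = {1} \<times> (\<lambda>u. moment_curve (of_int (t0 + s * u))) ` U"
    by (auto simp: V_def)
  then show ?thesis
    by (simp add: A_def lattice_config_convex_hull)
qed

text \<open>Since \<open>s\<close> is its own inverse, u = s (t - t0) is an integral substitution,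
  so \<open>q\<close> is again an integer polynomial of degree at most 4 in the original
  parameter.\<close>

lemma functional:
  fixes q :: "int poly"
  assumes "degree q \<le> 4"
  obtains L :: "real \<times> (real ^ 'd::{finite,linorder}) \<Rightarrow> real"
  where "linear L" "\<And>u. L (V u) = of_int (poly q u)" "\<And>z. z \<in> lattice \<Longrightarrow> L z \<in> \<int>"
proof -
  define p where "p = pcompose q [:- s * t0, s:]"
  have "degree [:- s * t0, s:] \<le> 1" by simp
  then have "degree p \<le> degree q"
    unfolding p_def using degree_pcompose_le[of q "[:- s * t0, s:]"]
    by (metis dual_order.trans mult.right_neutral mult_le_mono2)
  with assms dim have "degree p \<le> CARD('d)" by linarith
  then obtain L :: "real \<times> (real ^ 'd::{finite,linorder}) \<Rightarrow> real" where
    L: "linear L" "\<And>t. L (1, moment_curve (of_int t)) = of_int (poly p t)"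
       "\<And>z. z \<in> lattice \<Longrightarrow> L z \<in> \<int>"
    by (rule polynomial_functional) blast
  have "poly p (t0 + s * u) = poly q u" for u
  proof -
    have "- s * t0 + (t0 + s * u) * s = (s * s) * u" by (simp add: algebra_simps)
    then show ?thesis using s by (simp add: p_def poly_pcompose)
  qed
  then have "L (V u) = of_int (poly q u)" for u
    using L(2)[of "t0 + s * u"] by (simp add: V_def)
  with L(1,3) show ?thesis by (intro that[of L])
qed

lemma functional_pt:
  assumes "linear L" "\<And>u. L (V u) = of_int (poly q u)"
  shows "L (pt x1 x2 x3 x4 x5) = x1 * of_int (poly q (- a)) + x2 * of_int (poly q 0)
    + x3 * of_int (poly q 1) + x4 * of_int (poly q c) + x5 * of_int (poly q b)"
  unfolding pt_def using assms by (simp add: linear_add linear_scale)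

lemma pt_add: "pt x1 x2 x3 x4 x5 + pt y1 y2 y3 y4 y5 = pt (x1+y1) (x2+y2) (x3+y3) (x4+y4) (x5+y5)"
  and pt_scale: "r *\<^sub>R pt x1 x2 x3 x4 x5 = pt (r*x1) (r*x2) (r*x3) (r*x4) (r*x5)"
  by (simp_all add: pt_def algebra_simps)

text \<open>Every coordinate of \<open>V u\<close> is an integer polynomial in \<open>u\<close>: the
  constant 1 or a power of \<open>t0 + s * u\<close>. Writing the integers as
  \<open>range real_of_int\<close> lets later proofs name the integer value.\<close>

lemma pt_lattice:
  assumes "\<And>\<phi> :: int poly. x1 * of_int (poly \<phi> (- a)) + x2 * of_int (poly \<phi> 0)
    + x3 * of_int (poly \<phi> 1) + x4 * of_int (poly \<phi> c) + x5 * of_int (poly \<phi> b) \<in> range real_of_int"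
  shows "pt x1 x2 x3 x4 x5 \<in> lattice"
proof -
  have "fst (pt x1 x2 x3 x4 x5) \<in> \<int>"
    using assms[of 1, folded Ints_def] unfolding pt_def by (simp add: V_def)
  moreover have "snd (pt x1 x2 x3 x4 x5) $ i \<in> \<int>" for i
    using assms[of "[:t0, s:] ^ card {..i}", folded Ints_def] unfolding pt_def
    by (simp add: V_def moment_curve_def algebra_simps)
  ultimately show ?thesis
    by (simp add: integer_points_def mem_Times_iff)
qed

lemma pt_hull:
  assumes "0 \<le> x1" "0 \<le> x2" "0 \<le> x3" "0 \<le> x4" "0 \<le> x5" "x1 + x2 + x3 + x4 + x5 = 1"
  shows "pt x1 x2 x3 x4 x5 \<in> convex hull (V ` U)"
proof -
  define y where "y i = [- a, 0, 1, c, b] ! i" for i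
  define x where "x i = [x1, x2, x3, x4, x5] ! i" for i
  have "(\<Sum>i\<in>{..<5::nat}. x i *\<^sub>R V (y i)) \<in> convex hull (V ` U)"
  proof (rule convex_sum)
    show "sum x {..<5} = 1" using assms(6) by (simp add: x_def eval_nat_numeral)
    fix i :: nat assume "i \<in> {..<5}"
    then have "i = 0 \<or> i = 1 \<or> i = 2 \<or> i = 3 \<or> i = 4" by auto
    then show "0 \<le> x i" "V (y i) \<in> convex hull (V ` U)"
      using assms(1-5) U(2) by (auto simp: x_def y_def intro!: hull_inc)
  qed auto
  then show ?thesis by (simp add: x_def y_def pt_def eval_nat_numeral)
qed

section \<open>Divided differences, and the hole in the group and in the cone\<close>

text \<open>The divided differences of \<open>V\<close> at \<open>(-a, 0, 1)\<close>, \<open>(-a, 0, 1, c)\<close> and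
  \<open>(-a, 0, 1, c, b)\<close>, with their Lagrange coefficients.\<close>

definition divdiff2 :: "real \<times> (real ^ 'd::{finite,linorder})" where
  "divdiff2 = pt (1 / (a * (a + 1))) (- 1 / a) (1 / (a + 1)) 0 0"

definition divdiff3 :: "real \<times> (real ^ 'd::{finite,linorder})" where
  "divdiff3 = pt (- 1 / (a * (a + 1) * (a + c))) (1 / (a * c)) (- 1 / ((a + 1) * (c - 1)))
    (1 / ((a + c) * c * (c - 1))) 0"

definition divdiff4 :: "real \<times> (real ^ 'd::{finite,linorder})" where
  "divdiff4 = pt (1 / (a * (a + 1) * (a + c) * (a + b))) (- 1 / (a * b * c))
    (1 / ((a + 1) * (c - 1) * (b - 1))) (- 1 / ((a + c) * c * (c - 1) * (b - c)))
    (1 / ((a + b) * b * (b - 1) * (b - c)))"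

text \<open>The factor \<open>c\<close> makes the coefficient 1/a of \<open>V 0\<close> in the
  \<open>divdiff3\<close> term cancel the -1/a from \<open>divdiff2\<close>. The total weight of
  \<open>V 0\<close> becomes 1 - 1/(a b c), just short of 1.\<close>

definition hole :: "real \<times> (real ^ 'd::{finite,linorder})" where
  "hole = V 0 + V 1 + divdiff2 + of_int c *\<^sub>R divdiff3 + divdiff4"

lemma real_bounds: "1 \<le> real_of_int a" "2 \<le> real_of_int c" "real_of_int c + 1 \<le> real_of_int b"
  using abc by linarith+

lemma nonzero: "real_of_int a \<noteq> 0" "real_of_int a + 1 \<noteq> 0" "real_of_int a + c \<noteq> 0"
  "real_of_int a + b \<noteq> 0" "real_of_int c \<noteq> 0" "real_of_int b \<noteq> 0" "real_of_int c - 1 \<noteq> 0"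
  "real_of_int b - 1 \<noteq> 0" "real_of_int b - c \<noteq> 0"
  using real_bounds by linarith+

lemmas nonzero' = nonzero nonzero[simplified]

lemma V_lattice: "V u \<in> lattice"
  by (simp add: V_def integer_points_def moment_curve_def)

lemma lattice_add:
  assumes "y \<in> lattice" "z \<in> lattice"
  shows "y + z \<in> lattice"
  using assms by (auto simp: integer_points_def mem_Times_iff)

lemma V_eq_pt: "V 0 = pt 0 1 0 0 0" "V 1 = pt 0 0 1 0 0"
  by (simp_all add: pt_def)

text \<open>Paired with an integer polynomial, each divided difference returns the Newton
  coefficient of the same order, which is an integer.\<close>

lemma divdiff_lattice: "divdiff2 \<in> lattice" "divdiff3 \<in> lattice" "divdiff4 \<in> lattice"
proof -
  \<comment> \<open>At each node the Newton form breaks off at the factor vanishing there; at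
    \<open>b\<close> the unknown remainder disappears.\<close>
  have N: "\<exists>d0 d1 d2 d3 d4. poly \<phi> (- a) = d0 \<and> poly \<phi> 0 = d0 + a * d1
      \<and> poly \<phi> 1 = d0 + (a + 1) * (d1 + d2)
      \<and> poly \<phi> c = d0 + (a + c) * (d1 + c * (d2 + (c - 1) * d3))
      \<and> poly \<phi> b = d0 + (a + b) * (d1 + b * (d2 + (b - 1) * (d3 + (b - c) * d4)))"
    for \<phi> :: "int poly"
  proof -
    obtain d0 d1 d2 d3 d4 r where
      \<phi>: "\<And>u. poly \<phi> u = d0 + (u - - a) * (d1 + (u - 0) * (d2 + (u - 1) *
         (d3 + (u - c) * (d4 + (u - b) * r u))))"
      by (rule newton_form[of \<phi> "- a" 0 1 c b]) blast
    show ?thesis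
      by (intro exI[of _ d0] exI[of _ d1] exI[of _ d2] exI[of _ d3] exI[of _ d4])
        (simp add: \<phi> algebra_simps)
  qed
  show "divdiff2 \<in> lattice"
    unfolding divdiff2_def
  proof (rule pt_lattice, goal_cases)
    case (1 \<phi>)
    from N[of \<phi>] obtain d0 d1 d2 d3 d4 where v:
      "poly \<phi> (- a) = d0"
      "poly \<phi> 0 = d0 + a * d1"
      "poly \<phi> 1 = d0 + (a + 1) * (d1 + d2)"
      by blast
    show ?case
      unfolding v by (rule range_eqI[of _ _ d2]) (simp add: nonzero' divide_simps, simp add: algebra_simps)
  qed
  show "divdiff3 \<in> lattice"
    unfolding divdiff3_def
  proof (rule pt_lattice, goal_cases)
    case (1 \<phi>)
    from N[of \<phi>] obtain d0 d1 d2 d3 d4 where v: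
      "poly \<phi> (- a) = d0"
      "poly \<phi> 0 = d0 + a * d1"
      "poly \<phi> 1 = d0 + (a + 1) * (d1 + d2)"
      "poly \<phi> c = d0 + (a + c) * (d1 + c * (d2 + (c - 1) * d3))"
      by blast
    show ?case
      unfolding v by (rule range_eqI[of _ _ d3]) (simp add: nonzero' divide_simps, algebra)
  qed
  show "divdiff4 \<in> lattice"
    unfolding divdiff4_def
  proof (rule pt_lattice, goal_cases)
    case (1 \<phi>)
    from N[of \<phi>] obtain d0 d1 d2 d3 d4 where v:
      "poly \<phi> (- a) = d0"
      "poly \<phi> 0 = d0 + a * d1"
      "poly \<phi> 1 = d0 + (a + 1) * (d1 + d2)"
      "poly \<phi> c = d0 + (a + c) * (d1 + c * (d2 + (c - 1) * d3))"
      "poly \<phi> b = d0 + (a + b) * (d1 + b * (d2 + (b - 1) * (d3 + (b - c) * d4)))"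
      by blast
    show ?case
      unfolding v by (rule range_eqI[of _ _ d4]) (simp add: nonzero' divide_simps, algebra)
  qed
qed

lemma V_in_A: "u \<in> U \<Longrightarrow> V u \<in> A"
  unfolding A_def using V_lattice by (auto intro: hull_inc)

text \<open>The weights below are written as sums and products of terms 1/n and 1 - 1/n, so that
  these bounds give their nonnegativity by introduction rules alone.\<close>

lemma inverse_bounds:
  assumes "1 \<le> (n::int)"
  shows "0 \<le> 1 / real_of_int n" "0 \<le> 1 - 1 / real_of_int n"
proof -
  have "1 \<le> real_of_int n" using assms by linarith
  then show "0 \<le> 1 / real_of_int n" "0 \<le> 1 - 1 / real_of_int n" by simp_all
qed

lemma mult_ge_1: "1 \<le> m \<Longrightarrow> 1 \<le> n \<Longrightarrow> 1 \<le> m * (n::int)"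
  by (metis mult_mono' mult.right_neutral zero_le_one)

lemma pt_cong:
  "x1 = y1 \<Longrightarrow> x2 = y2 \<Longrightarrow> x3 = y3 \<Longrightarrow> x4 = y4 \<Longrightarrow> x5 = y5 \<Longrightarrow> pt x1 x2 x3 x4 x5 = pt y1 y2 y3 y4 y5"
  by simp

text \<open>Divided differences have total weight 0, so each partial sum has weight 1. Its negative
  contributions are absorbed by earlier terms, which leaves a convex combination. Differences of
  these points bring \<open>divdiff3\<close> and \<open>divdiff4\<close> into the group.\<close>

lemma newton_partial_sums_in_A:
  "V 0 + divdiff2 \<in> A" "V 0 + divdiff2 + divdiff3 \<in> A"
  "V 0 + divdiff2 + divdiff3 + divdiff4 \<in> A"
proof -
  have ge: "1 \<le> a" "1 \<le> a + 1" "1 \<le> a + c" "1 \<le> a + b" "1 \<le> c" "1 \<le> c - 1" "1 \<le> b" "1 \<le> b - 1" "1 \<le> b - c"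
    using abc by auto
  note ge1 = inverse_bounds[OF ge(1)] inverse_bounds[OF ge(2)] inverse_bounds[OF ge(3)]
    inverse_bounds[OF ge(4)] inverse_bounds[OF ge(5)] inverse_bounds[OF ge(6)]
    inverse_bounds[OF ge(7)] inverse_bounds[OF ge(8)] inverse_bounds[OF ge(9)]
  note nonneg = add_nonneg_nonneg mult_nonneg_nonneg ge1 order_refl
  have 3: "V 0 + divdiff2 = pt (1 / a * (1 / (a + 1))) (1 - 1 / a) (1 / (a + 1)) 0 0"
    unfolding V_eq_pt divdiff2_def pt_add by (rule pt_cong) auto
  have 4: "V 0 + divdiff2 + divdiff3 = pt (1 / a * (1 / (a + 1)) * (1 - 1 / real_of_int (a + c)))
      (1 - 1 / a + 1 / a * (1 / c)) (1 / (a + 1) * (1 - 1 / real_of_int (c - 1)))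
      (1 / (a + c) * (1 / c) * (1 / (c - 1))) 0"
    unfolding V_eq_pt divdiff2_def divdiff3_def pt_add
    by (rule pt_cong) (auto simp: right_diff_distrib diff_divide_distrib mult_ac)
  have 5: "V 0 + divdiff2 + divdiff3 + divdiff4 = pt
      (1 / a * (1 / (a + 1)) * (1 - 1 / real_of_int (a + c)) + 1 / a * (1 / (a + 1)) * (1 / (a + c)) * (1 / (a + b)))
      (1 - 1 / a + 1 / a * (1 / c) * (1 - 1 / real_of_int b))
      (1 / (a + 1) * (1 - 1 / real_of_int (c - 1)) + 1 / (a + 1) * (1 / (c - 1)) * (1 / (b - 1)))
      (1 / (a + c) * (1 / c) * (1 / (c - 1)) * (1 - 1 / real_of_int (b - c)))
      (1 / (a + b) * (1 / b) * (1 / (b - 1)) * (1 / (b - c)))"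
    unfolding V_eq_pt divdiff2_def divdiff3_def divdiff4_def pt_add
    by (rule pt_cong) (auto simp: right_diff_distrib diff_divide_distrib mult_ac)
  have lat: "V 0 + divdiff2 \<in> lattice" "V 0 + divdiff2 + divdiff3 \<in> lattice"
    "V 0 + divdiff2 + divdiff3 + divdiff4 \<in> lattice"
    by (intro lattice_add V_lattice divdiff_lattice)+
  have "V 0 + divdiff2 \<in> convex hull (V ` U)"
    unfolding 3
    \<comment> \<open>Only the equation saying that the weights add up to 1 is left for the
      arithmetic.\<close>
    by (intro pt_hull nonneg) (simp add: nonzero' divide_simps, algebra)
  then show "V 0 + divdiff2 \<in> A" using lat unfolding A_def by blast
  have "V 0 + divdiff2 + divdiff3 \<in> convex hull (V ` U)"
    unfolding 4
    by (intro pt_hull nonneg) (simp add: nonzero' divide_simps, algebra)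
  then show "V 0 + divdiff2 + divdiff3 \<in> A" using lat unfolding A_def by blast
  have "V 0 + divdiff2 + divdiff3 + divdiff4 \<in> convex hull (V ` U)"
    unfolding 5
    by (intro pt_hull nonneg) (simp add: nonzero' divide_simps, algebra)
  then show "V 0 + divdiff2 + divdiff3 + divdiff4 \<in> A" using lat unfolding A_def by blast
qed

lemma hole_in_group: "hole + of_nat k *\<^sub>R V 0 \<in> combinations \<int> A"
proof -
  have add: "y + z \<in> combinations \<int> A" if "y \<in> combinations \<int> A" "z \<in> combinations \<int> A" for y z
    using that by (intro combinations_add) auto
  \<comment> \<open>The terms with coefficients \<open>c - 1\<close> and \<open>1 - c\<close>
    together contribute \<open>c - 1\<close> further copies of \<open>divdiff3\<close>.\<close>
  have "hole + of_nat k *\<^sub>R V 0 = 1 *\<^sub>R V 1 + 1 *\<^sub>R (V 0 + divdiff2 + divdiff3 + divdiff4)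
      + of_int (c - 1) *\<^sub>R (V 0 + divdiff2 + divdiff3) + of_int (1 - c) *\<^sub>R (V 0 + divdiff2)
      + of_nat k *\<^sub>R V 0"
    by (simp add: hole_def algebra_simps)
  also have "\<dots> \<in> combinations \<int> A"
    using U(2) by (intro add combinations_base newton_partial_sums_in_A V_in_A) auto
  finally show ?thesis .
qed

lemma hole_eq_pt: "hole = pt
    (1 / (a + 1) * (1 / (a + c)) + 1 / a * (1 / (a + 1)) * (1 / (a + c)) * (1 / (a + b)))
    (1 - 1 / real_of_int (a * (b * c)))
    (1 - 1 / real_of_int ((a + 1) * (c - 1)) + 1 / (a + 1) * (1 / (c - 1)) * (1 / (b - 1)))
    (1 / (a + c) * (1 / (c - 1)) * (1 - 1 / real_of_int (c * (b - c))))
    (1 / (a + b) * (1 / b) * (1 / (b - 1)) * (1 / (b - c)))"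
  unfolding hole_def V_eq_pt divdiff2_def divdiff3_def divdiff4_def pt_add pt_scale
  by (rule pt_cong; simp add: nonzero' divide_simps; (simp add: algebra_simps)?)

text \<open>In the form \<open>hole_eq_pt\<close> all five weights are visibly nonnegative
  rationals, and adding multiples of \<open>V 0\<close> keeps this.\<close>

lemma hole_in_cone: "hole + of_nat k *\<^sub>R V 0 \<in> combinations {q \<in> \<rat>. 0 \<le> q} A"
proof -
  have ge: "1 \<le> a" "1 \<le> a + 1" "1 \<le> a + c" "1 \<le> a + b" "1 \<le> c" "1 \<le> c - 1" "1 \<le> b" "1 \<le> b - 1" "1 \<le> b - c"
    using abc by auto
  note bounds = inverse_bounds[OF ge(1)] inverse_bounds[OF ge(2)] inverse_bounds[OF ge(3)]
    inverse_bounds[OF ge(4)] inverse_bounds[OF ge(6)]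
    inverse_bounds[OF ge(7)] inverse_bounds[OF ge(8)] inverse_bounds[OF ge(9)]
    inverse_bounds[OF mult_ge_1[OF ge(1) mult_ge_1[OF ge(7,5)]]]
    inverse_bounds[OF mult_ge_1[OF ge(2,6)]] inverse_bounds[OF mult_ge_1[OF ge(5,9)]]
  have add: "y + z \<in> combinations {q \<in> \<rat>. 0 \<le> q} A"
    if "y \<in> combinations {q \<in> \<rat>. 0 \<le> q} A" "z \<in> combinations {q \<in> \<rat>. 0 \<le> q} A" for y z
    using that by (intro combinations_add) auto
  show ?thesis
    unfolding hole_eq_pt pt_def
    by (intro add combinations_base V_in_A CollectI conjI add_nonneg_nonneg mult_nonneg_nonneg
        bounds of_nat_0_le_iff Rats_add Rats_diff Rats_mult Rats_divide Rats_of_int Rats_of_nat Rats_1)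
      (use U(2) in auto)
qed

section \<open>Excluding the hole from the semigroup\<close>

lemma functional_nonneg:
  fixes L :: "real \<times> (real ^ 'd::{finite,linorder}) \<Rightarrow> real"
  assumes "linear L" "\<And>u. L (V u) = of_int (poly q u)" "\<And>u. u \<in> U \<Longrightarrow> 0 \<le> poly q u" "y \<in> A"
  shows "0 \<le> L y"
proof (rule linear_nonneg_on_convex_hull[OF assms(1)])
  show "0 \<le> L v" if "v \<in> V ` U" for v
    using that assms(2,3) by auto
  show "y \<in> convex hull (V ` U)"
    using assms(4) by (simp add: A_def)
qed

text \<open>u (u - 1) is nonnegative at integers and vanishes only at 0 and 1, so \<open>y\<close>
  lies on the segment from \<open>V 0\<close> to \<open>V 1\<close>. There the functional of the
  polynomial u is integral at lattice points, which leaves the endpoints.\<close>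

lemma edge_points:
  fixes L :: "real \<times> (real ^ 'd::{finite,linorder}) \<Rightarrow> real"
  assumes L: "linear L" "\<And>u. L (V u) = of_int (u * (u - 1))" and y: "y \<in> A" "L y = 0"
  shows "y = V 0 \<or> y = V 1"
proof -
  have "finite (V ` U)" using U(1) by simp
  moreover have "y \<in> convex hull (V ` U)" using y by (simp add: A_def)
  ultimately obtain w where w: "\<forall>v\<in>V ` U. 0 \<le> w v" "sum w (V ` U) = 1" "(\<Sum>v\<in>V ` U. w v *\<^sub>R v) = y"
    unfolding convex_hull_finite[OF \<open>finite (V ` U)\<close>] by auto
  have Lnn: "0 \<le> L v" if "v \<in> V ` U" for v
    using that L(2) by (auto simp: zero_le_mult_iff)
  have "(\<Sum>v\<in>V ` U. w v * L v) = 0"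
    using y(2) unfolding w(3)[symmetric] by (simp add: linear_sum[OF L(1)] linear_scale[OF L(1)])
  then have "\<forall>v\<in>V ` U. w v * L v = 0"
    using w(1) Lnn \<open>finite (V ` U)\<close>
    by (subst (asm) sum_nonneg_eq_0_iff) (blast intro: mult_nonneg_nonneg)+
  then have zero: "w v = 0" if "v \<in> V ` U - {V 0, V 1}" for v
    using that L(2) by auto
  have sub: "{V 0, V 1} \<subseteq> V ` U" using U(2) by auto
  have edge: "(\<Sum>v\<in>{V 0, V 1}. w v *\<^sub>R v) = y" "sum w {V 0, V 1} = 1"
    using w(2,3) zero sub \<open>finite (V ` U)\<close>
    by (simp_all add: sum.mono_neutral_left[of "V ` U" "{V 0, V 1}"])
  have "(\<Sum>v\<in>{V 0, V 1}. w v *\<^sub>R v) \<in> convex hull {V 0, V 1}"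
    using w(1) sub by (intro convex_sum edge(2)) (auto intro: hull_inc)
  then have "y \<in> convex hull {V 0, V 1}"
    by (simp only: edge(1))
  then obtain r t where rt: "0 \<le> r" "0 \<le> t" "r + t = 1" "y = r *\<^sub>R V 0 + t *\<^sub>R V 1"
    by (auto simp: convex_hull_2)
  obtain M :: "real \<times> (real ^ 'd::{finite,linorder}) \<Rightarrow> real"
    where M: "linear M" "\<And>u. M (V u) = of_int (poly [:0, 1:] u)" "\<And>z. z \<in> lattice \<Longrightarrow> M z \<in> \<int>"
    by (rule functional[of "[:0, 1:]"]) auto
  have "M y = t"
    unfolding rt(4) by (simp add: linear_add[OF M(1)] linear_scale[OF M(1)] M(2))
  moreover have "M y \<in> \<int>" using y(1) by (intro M(3)) (simp add: A_def)
  ultimately obtain j where "t = of_int j" by (auto elim: Ints_cases)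
  with rt(1-3) have "j = 0 \<or> j = 1" by auto
  then show ?thesis using rt(3,4) \<open>t = of_int j\<close> by auto
qed

lemma fst_V: "fst (V u) = of_int (poly 1 u)"
  by (simp add: V_def)

lemma hole_not_in_semigroup: "hole + of_nat k *\<^sub>R V 0 \<notin> combinations \<nat> A"
proof
  assume "hole + of_nat k *\<^sub>R V 0 \<in> combinations \<nat> A"
  then obtain F n where F: "finite F" "F \<subseteq> A" "\<forall>y\<in>F. n y \<in> \<nat>"
    and x: "hole + of_nat k *\<^sub>R V 0 = (\<Sum>y\<in>F. n y *\<^sub>R y)"
    unfolding combinations_def by blast
  have n: "0 \<le> n y" if "y \<in> F" for y using F(3) that by (auto elim!: Nats_cases)
  define f :: "int poly" where "f = [:0, -1, 1:]"
  obtain L :: "real \<times> (real ^ 'd::{finite,linorder}) \<Rightarrow> real"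
    where L: "linear L" "\<And>u. L (V u) = of_int (poly f u)" "\<And>z. z \<in> lattice \<Longrightarrow> L z \<in> \<int>"
    by (rule functional[of f]) (auto simp: f_def)
  have L': "L (V u) = of_int (u * (u - 1))" for u
    by (simp add: L(2) f_def algebra_simps)
  have Lnn: "0 \<le> L y" if "y \<in> F" for y
    by (rule functional_nonneg[OF L(1,2)]) (use that F(2) in \<open>auto simp: f_def zero_le_mult_iff\<close>)
  \<comment> \<open>\<open>L\<close> kills \<open>V 0\<close> and \<open>V 1\<close>, and as
    \<open>f\<close> is monic quadratic it is 1 on \<open>divdiff2\<close> and 0 on the higher
    differences.\<close>
  have "L hole = 1"
    unfolding hole_eq_pt functional_pt[OF L(1,2)] f_def
    by (simp add: nonzero' divide_simps, algebra)
  then have sum1: "(\<Sum>y\<in>F. n y * L y) = 1"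
    using arg_cong[OF x, of L]
    by (simp add: linear_add[OF L(1)] linear_scale[OF L(1)] linear_sum[OF L(1)] L')
  then have "(\<Sum>y\<in>F. n y * L y) \<noteq> 0" by linarith
  then obtain p where p: "p \<in> F" "n p * L p \<noteq> 0"
    by (rule sum.not_neutral_contains_not_neutral)
  have pA: "p \<in> A" using p F by auto
  have "n p \<in> \<int>" using F(3) p(1) Nats_subset_Ints by blast
  moreover have "L p \<in> \<int>" using pA by (intro L(3)) (simp add: A_def)
  ultimately have ge1: "1 \<le> n p" "1 \<le> L p"
    using Ints_nonzero_abs_ge1[of "n p"] Ints_nonzero_abs_ge1[of "L p"] n[OF p(1)] Lnn[OF p(1)] p(2)
    by fastforce+
  have ge: "n p \<le> n p * L p" "1 \<le> n p * L p"
    using mult_left_mono[of 1 "L p" "n p"] ge1 by linarith+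
  have split: "n p * L p + (\<Sum>y\<in>F - {p}. n y * L y) = 1"
    using sum1 sum.remove[OF F(1) p(1), of "\<lambda>y. n y * L y"] by linarith
  have nn: "0 \<le> n y * L y" if "y \<in> F - {p}" for y using that n Lnn by (intro mult_nonneg_nonneg) blast+
  then have "0 \<le> (\<Sum>y\<in>F - {p}. n y * L y)" by (rule sum_nonneg)
  \<comment> \<open>A total of 1 made of nonnegative integers: the nonzero term \<open>p\<close>
    occurs once and uses up everything.\<close>
  with split ge have np: "n p = 1" and rest: "(\<Sum>y\<in>F - {p}. n y * L y) = 0"
    using ge1 by linarith+
  have edge: "y = V 0 \<or> y = V 1" if y: "y \<in> F - {p}" "n y \<noteq> 0" for y
  proof (rule edge_points[OF L(1) L'])
    show "y \<in> A" using y(1) F(2) by blast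
    have "n y * L y = 0"
      using sum_nonneg_0[OF finite_Diff[OF F(1)], of "{p}" "\<lambda>y. n y * L y" y] nn rest y(1) by blast
    with y(2) show "L y = 0" by simp
  qed
  have decomp: "hole + of_nat k *\<^sub>R V 0 = p + (\<Sum>y\<in>F - {p}. n y *\<^sub>R y)"
    using sum.remove[OF F(1) p(1), of "\<lambda>y. n y *\<^sub>R y"] np x by simp

  define g :: "int poly" where "g = [:0, 1:] * [:a, 1:] * [:- c, 1:] * [:- c - 1, 1:]"
  have "degree g \<le> 4" unfolding g_def by simp
  then obtain G :: "real \<times> (real ^ 'd::{finite,linorder}) \<Rightarrow> real"
    where G: "linear G" "\<And>u. G (V u) = of_int (poly g u)" "\<And>z. z \<in> lattice \<Longrightarrow> G z \<in> \<int>"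
    by (rule functional) auto
  have g: "poly g u = u * (u + a) * ((u - c) * (u - c - 1))" for u
    by (simp add: g_def algebra_simps)
  have gnn: "0 \<le> poly g u" if "u \<in> U" for u
  proof -
    \<comment> \<open>A product of two consecutive integers is never negative.\<close>
    have "0 \<le> (u - c) * (u - c - 1)" by (simp add: zero_le_mult_iff) linarith
    moreover have "u = - a \<or> 0 \<le> u" using that U(3) abc by auto
    moreover have "0 \<le> u * (u + a)" using calculation(2) abc by auto
    ultimately show ?thesis unfolding g by simp
  qed
  have Gnn: "0 \<le> G y" if "y \<in> F" for y
    by (rule functional_nonneg[OF G(1,2)]) (use that F(2) gnn in \<open>auto\<close>)
  \<comment> \<open>The Newton coefficients of \<open>g\<close> of orders 2, 3, 4 are c (c - 1), -c
    and 1, so \<open>divdiff2\<close>, \<open>c\<close> times \<open>divdiff3\<close> and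
    \<open>divdiff4\<close> add up to 1 - c, which is negative.\<close>
  have "G hole = of_int (poly g 1) - of_int c + 1"
    unfolding hole_eq_pt functional_pt[OF G(1,2)] g
    by (simp add: nonzero' divide_simps, algebra)
  then have "G (hole + of_nat k *\<^sub>R V 0) < G (V 1)"
    using abc by (simp add: linear_add[OF G(1)] linear_scale[OF G(1)] G(2) g[of 0])
  then have less: "G p + (\<Sum>y\<in>F - {p}. n y * G y) < G (V 1)"
    unfolding decomp by (simp add: linear_add[OF G(1)] linear_scale[OF G(1)] linear_sum[OF G(1)])
  \<comment> \<open>\<open>G\<close> vanishes at \<open>V 0\<close>, so one copy of
    \<open>V 1\<close> would already exceed the value of \<open>G\<close> on the left-hand
    side.\<close>
  have only0: "y = V 0" if y: "y \<in> F - {p}" "n y \<noteq> 0" for y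
  proof (rule ccontr)
    assume "y \<noteq> V 0"
    with edge[OF y] have "y = V 1" by simp
    have "n y \<in> \<int>" using F(3) y Nats_subset_Ints by blast
    then have "1 \<le> n y" using Ints_nonzero_abs_ge1[of "n y"] n[of y] y by simp
    moreover have "0 \<le> G y" using Gnn y by blast
    ultimately have "G y \<le> n y * G y" using mult_right_mono[of 1 "n y" "G y"] by simp
    also have "\<dots> \<le> (\<Sum>y\<in>F - {p}. n y * G y)"
      using y F(1) n Gnn by (intro member_le_sum mult_nonneg_nonneg) blast+
    finally show False using less Gnn[OF p(1)] \<open>y = V 1\<close> by simp
  qed
  have "(\<Sum>y\<in>F - {p}. n y *\<^sub>R y) = (\<Sum>y\<in>F - {p}. n y *\<^sub>R V 0)"
    using only0 by (intro sum.cong refl) (metis scaleR_zero_left)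
  then have decomp0: "hole + of_nat k *\<^sub>R V 0 = p + (\<Sum>y\<in>F - {p}. n y) *\<^sub>R V 0"
    using decomp by (simp add: scaleR_left.sum)

  define h :: "int poly" where "h = [:a, 1:] * [:-1, 1:] * [:- c, 1:] * [:b, -1:]"
  have "degree h \<le> 4" unfolding h_def by simp
  then obtain H :: "real \<times> (real ^ 'd::{finite,linorder}) \<Rightarrow> real"
    where H: "linear H" "\<And>u. H (V u) = of_int (poly h u)" "\<And>z. z \<in> lattice \<Longrightarrow> H z \<in> \<int>"
    by (rule functional) auto
  have h: "poly h u = (u + a) * (u - 1) * ((u - c) * (b - u))" for u
    by (simp add: h_def algebra_simps)
  have hnn: "0 \<le> poly h u" if "u \<in> U" for u
  proof -
    consider "u = - a" | "u = 0" | "u = 1" | "c \<le> u" "u \<le> b" using U(3) \<open>u \<in> U\<close> by auto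
    then show ?thesis
      using abc by cases (auto simp: h mult_nonneg_nonneg)
  qed
  have Hp: "0 \<le> H p"
    by (rule functional_nonneg[OF H(1,2)]) (use pA hnn in \<open>auto\<close>)
  \<comment> \<open>Among the five nodes \<open>h\<close> is nonzero only at 0, with value a b c;
    there the weight is 1 - 1/(a b c).\<close>
  have hH: "H hole = of_int (poly h 0) - 1"
    unfolding hole_eq_pt functional_pt[OF H(1,2)] h
    by (simp add: nonzero' divide_simps)
  have "fst p = 1"
  proof -
    have "A \<subseteq> {1} \<times> UNIV"
      unfolding A_def by (rule le_infI1, rule hull_minimal) (auto simp: V_def convex_Times)
    with pA show ?thesis by auto
  qed
  \<comment> \<open>Comparing first coordinates forces \<open>k + 1\<close> copies of
    \<open>V 0\<close>, hence \<open>hole = p + V 0\<close> and \<open>H p\<close> = -1.\<close>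
  have "fst hole = 2"
    unfolding hole_eq_pt functional_pt[of fst 1, OF linear_fst fst_V]
    by (simp add: nonzero' divide_simps, algebra)
  then have "(\<Sum>y\<in>F - {p}. n y) = of_nat k + 1"
    using arg_cong[OF decomp0, of fst] \<open>fst p = 1\<close> by (simp add: V_def)
  then have "H hole = H p + of_int (poly h 0)"
    using arg_cong[OF decomp0, of H]
    by (simp add: linear_add[OF H(1)] linear_scale[OF H(1)] H(2) algebra_simps)
  then show False using Hp hH by linarith
qed

lemma not_very_ample:
  "\<not> very_ample (convex hull ((\<lambda>u. moment_curve (of_int (t0 + s * u)) :: real ^ 'd::{finite,linorder}) ` U))"
proof -
  have "range (\<lambda>k. hole + of_nat k *\<^sub>R V 0)
      \<subseteq> combinations \<int> A \<inter> combinations {q \<in> \<rat>. 0 \<le> q} A - combinations \<nat> A"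
    using hole_in_group hole_in_cone hole_not_in_semigroup by blast
  \<comment> \<open>The first coordinate of \<open>V 0\<close> is 1, so distinct \<open>k\<close>
    give distinct points.\<close>
  moreover have "inj (\<lambda>k::nat. hole + of_nat k *\<^sub>R V 0)"
    by (rule injI) (auto simp: V_def)
  then have "infinite (range (\<lambda>k::nat. hole + of_nat k *\<^sub>R V 0))"
    by (simp add: finite_image_iff)
  ultimately show ?thesis
    unfolding very_ample_def A_eq using finite_subset by blast
qed

end

section \<open>Reduction of both alternatives to normalised parameters\<close>

theorem theorem3p1:
  fixes d n :: nat and \<tau> :: "nat \<Rightarrow> int"
  assumes "CARD('d::{finite,linorder}) = d"
    and "n \<ge> d + 1"
    and "d \<ge> 4"
    and "strict_mono_on {1..n} \<tau>"
    and "\<tau> 3 - \<tau> 2 = 1 \<or> \<tau> (n - 1) - \<tau> (n - 2) = 1"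
  shows "\<not> very_ample (cyclic_polytope n (\<lambda>i. of_int (\<tau> i)) :: (real ^ 'd::{finite,linorder}) set)"
proof -
  have n: "5 \<le> n" using assms(2,3) by simp
  have less: "\<tau> i < \<tau> j" if "1 \<le> i" "i < j" "j \<le> n" for i j
    using strict_mono_onD[OF assms(4), of i j] that by simp
  have le: "\<tau> i \<le> \<tau> j" if "1 \<le> i" "i \<le> j" "j \<le> n" for i j
    using less[of i j] that by (cases "i = j") auto
  have main: "\<not> very_ample (cyclic_polytope n (\<lambda>i. of_int (\<tau> i)) :: (real ^ 'd::{finite,linorder}) set)"
    if "s * s = 1" "1 \<le> a" "2 \<le> c" "c < b"
      and U: "{- a, 0, 1, c, b} \<subseteq> (\<lambda>i. s * (\<tau> i - t0)) ` {1..n}"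
        "(\<lambda>i. s * (\<tau> i - t0)) ` {1..n} \<subseteq> {- a, 0, 1} \<union> {c..b}"
    for s t0 a b c
  proof -
    let ?V = "\<lambda>u. (1, moment_curve (of_int (t0 + s * u))) :: real \<times> (real ^ 'd::{finite,linorder})"
    have "consecutive_pair s t0 a b c ((\<lambda>i. s * (\<tau> i - t0)) ` {1..n}) ?V"
      by unfold_locales (use that assms(1,3) in auto)
    from consecutive_pair.not_very_ample[OF this]
    have "\<not> very_ample (convex hull
        ((\<lambda>i. moment_curve (of_int (t0 + s * (s * (\<tau> i - t0)))) :: real ^ 'd::{finite,linorder}) ` {1..n}))"
      by (simp only: image_image not_False_eq_True)
    moreover have undo: "t0 + s * (s * (\<tau> i - t0)) = \<tau> i" for i
      by (simp only: mult.assoc[symmetric] \<open>s * s = 1\<close> mult_1 add_diff_cancel_left' add_diff_eq)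
    moreover have "{moment_curve (of_int (\<tau> i)) | i. 1 \<le> i \<and> i \<le> n}
        = (\<lambda>i. moment_curve (of_int (\<tau> i)) :: real ^ 'd::{finite,linorder}) ` {1..n}"
      by auto
    ultimately show ?thesis
      unfolding cyclic_polytope_def by (simp only: undo not_False_eq_True)
  qed
  from assms(5) show ?thesis
  proof
    assume "\<tau> 3 - \<tau> 2 = 1"
    let ?u = "\<lambda>i. 1 * (\<tau> i - \<tau> 2)"
    show ?thesis
    \<comment> \<open>With origin at \<open>\<tau> 2\<close>, the parameter \<open>\<tau> 3\<close>
      becomes 1; 5 \<le> n keeps \<open>\<tau> 4\<close> and \<open>\<tau> n\<close>
      distinct.\<close>
    proof (rule main[of 1 "\<tau> 2 - \<tau> 1" "\<tau> 4 - \<tau> 2" "\<tau> n - \<tau> 2" "\<tau> 2"])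
      show "1 \<le> \<tau> 2 - \<tau> 1" "2 \<le> \<tau> 4 - \<tau> 2" "\<tau> 4 - \<tau> 2 < \<tau> n - \<tau> 2"
        using less[of 1 2] less[of 3 4] less[of 4 n] n \<open>\<tau> 3 - \<tau> 2 = 1\<close> by auto
      have "{?u 1, ?u 2, ?u 3, ?u 4, ?u n} \<subseteq> ?u ` {1..n}"
        using n by (intro insert_subsetI empty_subsetI imageI) auto
      then show "{- (\<tau> 2 - \<tau> 1), 0, 1, \<tau> 4 - \<tau> 2, \<tau> n - \<tau> 2} \<subseteq> ?u ` {1..n}"
        using \<open>\<tau> 3 - \<tau> 2 = 1\<close> by simp
      show "?u ` {1..n} \<subseteq> {- (\<tau> 2 - \<tau> 1), 0, 1} \<union> {\<tau> 4 - \<tau> 2..\<tau> n - \<tau> 2}"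
      proof (intro image_subsetI)
        fix i assume "i \<in> {1..n}"
        then consider "i = 1" | "i = 2" | "i = 3" | "4 \<le> i" "i \<le> n" by fastforce
        then show "?u i \<in> {- (\<tau> 2 - \<tau> 1), 0, 1} \<union> {\<tau> 4 - \<tau> 2..\<tau> n - \<tau> 2}"
          by cases (use \<open>\<tau> 3 - \<tau> 2 = 1\<close> le[of 4 i] le[of i n] in auto)
      qed
    qed simp
  next
    assume eq: "\<tau> (n - 1) - \<tau> (n - 2) = 1"
    let ?t = "\<tau> (n - 1)" and ?u = "\<lambda>i. - 1 * (\<tau> i - \<tau> (n - 1))"
    show ?thesis
    \<comment> \<open>The same picture read from the other end: \<open>\<tau> (n - 1)\<close> is the
      origin, \<open>\<tau> n\<close> becomes -a, and \<open>\<tau> (n - 2)\<close>,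
      \<open>\<tau> (n - 3)\<close>, \<open>\<tau> 1\<close> become 1, c, b.\<close>
    proof (rule main[of "- 1" "\<tau> n - ?t" "?t - \<tau> (n - 3)" "?t - \<tau> 1" ?t])
      show "1 \<le> \<tau> n - ?t" "2 \<le> ?t - \<tau> (n - 3)" "?t - \<tau> (n - 3) < ?t - \<tau> 1"
        using less[of "n - 1" n] less[of "n - 3" "n - 2"] less[of 1 "n - 3"] n eq by linarith+
      have "{?u n, ?u (n - 1), ?u (n - 2), ?u (n - 3), ?u 1} \<subseteq> ?u ` {1..n}"
        using n by (intro insert_subsetI empty_subsetI imageI) auto
      then show "{- (\<tau> n - ?t), 0, 1, ?t - \<tau> (n - 3), ?t - \<tau> 1} \<subseteq> ?u ` {1..n}"
        using eq by simp
      show "?u ` {1..n} \<subseteq> {- (\<tau> n - ?t), 0, 1} \<union> {?t - \<tau> (n - 3)..?t - \<tau> 1}"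
      proof (intro image_subsetI)
        fix i assume "i \<in> {1..n}"
        then consider "i = n" | "i = n - 1" | "i = n - 2" | "1 \<le> i" "i \<le> n - 3" by fastforce
        then show "?u i \<in> {- (\<tau> n - ?t), 0, 1} \<union> {?t - \<tau> (n - 3)..?t - \<tau> 1}"
          by cases (use eq le[of 1 i] le[of i "n - 3"] in auto)
      qed
    qed simp
  qed
qed

end
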